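(* Let $(A,(p_s)_{s\in S})$ be a locally convex algebra satisfying property (P). Let $B$ be a locally convex algebra, and let $\phi:A\to B$ be a one-to-one algebra homomorphism such that $\operatorname{Im}\phi$ (with the topology induced by $B$) is functionally continuous with continuous product and $C=\overline{\operatorname{Im}\phi}$ (the closure of $\operatorname{Im}\phi$ in $B$) is a Q-algebra. Then $\phi^{-1}:\operatorname{Im}\phi\to A$ is continuous.
   Context: A topological algebra is an (associative, not necessarily commutative or unital) algebra over $\mathbb{C}$ which is also a Hausdorff topological vector space such that the multiplication is separately continuous. A locally convex algebra $(A,(p_s)_{s\in S})$ is a topological algebra whose topology is locally convex, determined by the family of seminorms $(p_s)_{s\in S}$. "Continuous product" means that the multiplication is jointly continuous. $M^*(A)$ denotes the set of all nonzero multiplicative linear functionals $A\to\mathbb{C}$, and $M(A)$ the subset of the continuous ones. A topological algebra $D$ is functionally continuous if $M^*(D)=M(D)$. $(A,(p_s)_{s\in S})$ satisfies property (P) if $M^*(A)\ne\emptyset$ and for all $x\in A$ and every $s\in S$ with $p_s(x)=1$, there exists $f_0\in M^*(A)$ such that $|f_0(x)|\ge 1$. A topological algebra is a Q-algebra if the set of its quasi-invertible elements is open, where $x$ is quasi-invertible if there is $y$ with $x+y+xy=0=x+y+yx$. *)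

theory Defs
  imports "HOL-Analysis.Analysis"
begin

text \<open>
  Algebras over the complex numbers need not be unital or commutative: the ring structure comes from
  the class \<^class>\<open>ring\<close> (which has no unit), and scalar multiplication is an explicit
  parameter.  Multiplicative functionals, functional continuity, joint continuity of the product and
  the Q-property are defined for a subalgebra \<open>D\<close> of the ambient algebra, with all operations
  restricted to \<open>D\<close> and with the induced topology; the ambient algebra itself is the case
  \<open>D = UNIV\<close>.
\<close>

locale complex_algebra = vector_space smul
  for smul :: "complex \<Rightarrow> 'a::ring \<Rightarrow> 'a" +
  assumes scale_mult_left: "smul c x * y = smul c (x * y)"
    and scale_mult_right: "x * smul c y = smul c (x * y)"

locale topological_algebra = complex_algebra smul
  for smul :: "complex \<Rightarrow> 'a::{ring, topological_ab_group_add, t2_space} \<Rightarrow> 'a" +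
  assumes continuous_scale: "continuous_on UNIV (\<lambda>(c, x). smul c x)"
    and continuous_mult_left: "continuous_on UNIV (\<lambda>x::'a. a * x)"
    and continuous_mult_right: "continuous_on UNIV (\<lambda>x::'a. x * a)"

definition seminorm :: "(complex \<Rightarrow> 'a::ab_group_add \<Rightarrow> 'a) \<Rightarrow> ('a \<Rightarrow> real) \<Rightarrow> bool" where
  "seminorm smul q \<longleftrightarrow>
    (\<forall>x. 0 \<le> q x) \<and>
    (\<forall>x y. q (x + y) \<le> q x + q y) \<and>
    (\<forall>c x. q (smul c x) = cmod c * q x)"

text \<open>
  The family of seminorms is \<open>(p s)\<^bsub>s \<in> S\<^esub>\<close>.  It is not assumed to be directed, so basic
  neighbourhoods are given by finitely many seminorms.
\<close>

locale locally_convex_algebra = topological_algebra smul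
  for smul :: "complex \<Rightarrow> 'a::{ring, topological_ab_group_add, t2_space} \<Rightarrow> 'a" +
  fixes p :: "'s \<Rightarrow> 'a \<Rightarrow> real" and S :: "'s set"
  assumes seminorms: "s \<in> S \<Longrightarrow> seminorm smul (p s)"
    and open_iff_seminorms:
      "open U \<longleftrightarrow>
        (\<forall>x\<in>U. \<exists>F e. finite F \<and> F \<subseteq> S \<and> 0 < e \<and> {y. \<forall>s\<in>F. p s (y - x) < e} \<subseteq> U)"

text \<open>
  The set \<open>M\<^sup>*(D)\<close>.  Functionals on \<open>D\<close> are represented by functions on the ambient type that
  are \<^const>\<open>undefined\<close> outside \<open>D\<close>.
\<close>

definition mult_functionals ::
    "(complex \<Rightarrow> 'a::ring \<Rightarrow> 'a) \<Rightarrow> 'a set \<Rightarrow> ('a \<Rightarrow> complex) set" where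
  "mult_functionals smul D =
    {f \<in> extensional D.
      (\<forall>x\<in>D. \<forall>y\<in>D. f (x + y) = f x + f y) \<and>
      (\<forall>c. \<forall>x\<in>D. f (smul c x) = c * f x) \<and>
      (\<forall>x\<in>D. \<forall>y\<in>D. f (x * y) = f x * f y) \<and>
      (\<exists>x\<in>D. f x \<noteq> 0)}"

definition cont_mult_functionals ::
    "(complex \<Rightarrow> 'a::{ring, topological_space} \<Rightarrow> 'a) \<Rightarrow> 'a set \<Rightarrow> ('a \<Rightarrow> complex) set" where
  "cont_mult_functionals smul D = {f \<in> mult_functionals smul D. continuous_on D f}"

definition functionally_continuous ::
    "(complex \<Rightarrow> 'a::{ring, topological_space} \<Rightarrow> 'a) \<Rightarrow> 'a set \<Rightarrow> bool" where
  "functionally_continuous smul D \<longleftrightarrow>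
    mult_functionals smul D = cont_mult_functionals smul D"

definition continuous_product :: "'a::{ring, topological_space} set \<Rightarrow> bool" where
  "continuous_product D \<longleftrightarrow> continuous_on (D \<times> D) (\<lambda>(x, y). x * y)"

definition quasi_invertibles :: "'a::ring set \<Rightarrow> 'a set" where
  "quasi_invertibles D = {x \<in> D. \<exists>y\<in>D. x + y + x * y = 0 \<and> x + y + y * x = 0}"

definition Q_algebra :: "'a::{ring, topological_space} set \<Rightarrow> bool" where
  "Q_algebra D \<longleftrightarrow> openin (top_of_set D) (quasi_invertibles D)"

definition property_P ::
    "(complex \<Rightarrow> 'a::ring \<Rightarrow> 'a) \<Rightarrow> ('s \<Rightarrow> 'a \<Rightarrow> real) \<Rightarrow> 's set \<Rightarrow> bool" where
  "property_P smul p S \<longleftrightarrow>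
    mult_functionals smul UNIV \<noteq> {} \<and>
    (\<forall>x. \<forall>s\<in>S. p s x = 1 \<longrightarrow> (\<exists>f\<in>mult_functionals smul UNIV. 1 \<le> cmod (f x)))"

definition algebra_hom ::
    "(complex \<Rightarrow> 'a::ring \<Rightarrow> 'a) \<Rightarrow> (complex \<Rightarrow> 'b::ring \<Rightarrow> 'b) \<Rightarrow> ('a \<Rightarrow> 'b) \<Rightarrow> bool" where
  "algebra_hom scaleA scaleB \<phi> \<longleftrightarrow>
    Vector_Spaces.linear scaleA scaleB \<phi> \<and> (\<forall>x y. \<phi> (x * y) = \<phi> x * \<phi> y)"

end

theory Submission
  imports Defs
begin

text \<open>
  A functional in \<open>M\<^sup>*(Im \<phi>)\<close> is continuous, so it cannot take the value \<open>-1\<close> at an element that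
  is quasi-invertible in the closure \<open>C\<close>.  As \<open>C\<close> is a Q-algebra, a balanced neighbourhood \<open>V\<close> of
  \<open>0\<close> meets \<open>C\<close> in quasi-invertible elements only, and rescaling gives \<open>\<bar>f\<bar> < 1\<close> on
  \<open>V \<inter> Im \<phi>\<close> for all \<open>f\<close> at once.  Transporting functionals along \<open>\<phi>\<close>, property (P) turns
  this into \<open>p s < 1\<close> on \<open>\<phi>\<^sup>-\<^sup>1(V)\<close> for all \<open>s\<close>.
\<close>

lemma seminorm_scale: "seminorm smul q \<Longrightarrow> q (smul c x) = cmod c * q x"
  by (simp add: seminorm_def)

text \<open>By the triangle inequality, a point \<open>x\<close> of the ball of \<open>p s\<close>
  has room \<open>e - p s x\<close>; finitely many such balls are then intersected.\<close>

lemma (in locally_convex_algebra) open_seminorm_ball: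
  assumes "finite F" "F \<subseteq> S"
  shows "open {y. \<forall>s\<in>F. p s y < e}"
proof -
  have "open {y. p s y < e}" if "s \<in> F" for s
  proof -
    have sn: "seminorm smul (p s)" and s: "s \<in> S"
      using that assms(2) seminorms by auto
    have "\<exists>F e'. finite F \<and> F \<subseteq> S \<and> 0 < e' \<and> {y. \<forall>s\<in>F. p s (y - x) < e'} \<subseteq> {y. p s y < e}"
      if "p s x < e" for x
    proof -
      have "p s y < e" if "p s (y - x) < e - p s x" for y
      proof -
        have "p s ((y - x) + x) \<le> p s (y - x) + p s x"
          using sn unfolding seminorm_def by blast
        then show ?thesis using that by simp
      qed
      then show ?thesis
        using s that by (intro exI[of _ "{s}"] exI[of _ "e - p s x"]) auto
    qed
    then show ?thesis
      unfolding open_iff_seminorms by blast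
  qed
  moreover have "{y. \<forall>s\<in>F. p s y < e} = (\<Inter>s\<in>F. {y. p s y < e})"
    by auto
  ultimately show ?thesis
    using assms(1) by (simp add: open_INT)
qed

text \<open>If \<open>f y = -1\<close>, then \<open>f (y + w + y * w) = -1 + f w - f w = -1\<close>
  for every \<open>w\<close> in \<open>D\<close>. A quasi-inverse \<open>z\<close> makes this
  argument of \<open>f\<close> vanish, but \<open>z\<close> lies only in the closure, so it is
  approximated by such \<open>w\<close>, contradicting continuity of \<open>f\<close> at 0.\<close>

lemma (in topological_algebra) quasi_invertible_functional_neq:
  assumes f: "f \<in> cont_mult_functionals smul D"
    and y: "y \<in> D" "y \<in> quasi_invertibles (closure D)"
    and D: "0 \<in> D" "\<And>u v. u \<in> D \<Longrightarrow> v \<in> D \<Longrightarrow> u + v \<in> D"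
      "\<And>u v. u \<in> D \<Longrightarrow> v \<in> D \<Longrightarrow> u * v \<in> D"
  shows "f y \<noteq> -1"
proof
  assume fy: "f y = -1"
  obtain z where z: "z \<in> closure D" "y + z + y * z = 0"
    using y(2) unfolding quasi_invertibles_def by blast
  have add: "f (u + v) = f u + f v" and mult: "f (u * v) = f u * f v"
    if "u \<in> D" "v \<in> D" for u v
    using f that unfolding cont_mult_functionals_def mult_functionals_def by auto
  have f0: "f 0 = 0"
    using add[of 0 0] D(1) by simp
  have "continuous_on D f"
    using f by (simp add: cont_mult_functionals_def)
  then obtain W where W: "open W" "0 \<in> W" "\<And>w. w \<in> D \<Longrightarrow> w \<in> W \<Longrightarrow> f w \<in> ball 0 1"
    unfolding continuous_on_topological using D(1) f0
    by (metis centre_in_ball open_ball zero_less_one)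
  \<comment> \<open>With \<open>y\<close> fixed, separate continuity of the product makes this map
    continuous.\<close>
  have "open ((\<lambda>w. y + w + y * w) -` W)"
    by (intro open_vimage W continuous_intros continuous_mult_left)
  moreover have "z \<in> (\<lambda>w. y + w + y * w) -` W"
    using z W by simp
  ultimately obtain w where w: "w \<in> D" "y + w + y * w \<in> W"
    using z(1) by (auto simp: closure_iff_nhds_not_empty)
  have "f (y + w + y * w) = -1"
    using y w D by (simp add: add mult fy)
  with W(3)[of "y + w + y * w"] w y D show False by simp
qed

lemma mult_functionals_range:
  assumes hom: "algebra_hom scaleA scaleB \<phi>" and "inj \<phi>"
    and f: "f \<in> mult_functionals scaleA UNIV"
  shows "restrict (f \<circ> inv \<phi>) (range \<phi>) \<in> mult_functionals scaleB (range \<phi>)"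
proof -
  interpret Vector_Spaces.linear scaleA scaleB \<phi>
    using hom by (simp add: algebra_hom_def)
  have "restrict (f \<circ> inv \<phi>) (range \<phi>) (\<phi> a) = f a" for a
    using \<open>inj \<phi>\<close> by simp
  moreover have "\<phi> a * \<phi> b = \<phi> (a * b)" for a b
    using hom by (simp add: algebra_hom_def)
  \<comment> \<open>Sums, multiples and products of images are folded into a single image, where the
    transported functional takes the value of \<open>f\<close>.\<close>
  ultimately show ?thesis
    using f unfolding mult_functionals_def
    by (auto simp del: restrict_apply simp flip: add scale)
qed

text \<open>The ball comes from the Q-property before any functional is chosen, so it serves all of
  them at once.\<close>

lemma (in locally_convex_algebra) functionals_bounded_near_0:
  assumes "functionally_continuous smul D" and Q: "Q_algebra (closure D)"
    and D: "0 \<in> D" "\<And>u v. u \<in> D \<Longrightarrow> v \<in> D \<Longrightarrow> u + v \<in> D"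
      "\<And>u v. u \<in> D \<Longrightarrow> v \<in> D \<Longrightarrow> u * v \<in> D" "\<And>c u. u \<in> D \<Longrightarrow> smul c u \<in> D"
  obtains F e where "finite F" "F \<subseteq> S" "0 < e"
    "\<And>f y. f \<in> mult_functionals smul D \<Longrightarrow> y \<in> D \<Longrightarrow> \<forall>s\<in>F. p s y < e \<Longrightarrow> cmod (f y) < 1"
proof -
  obtain U where U: "open U" "quasi_invertibles (closure D) = closure D \<inter> U"
    using Q unfolding Q_algebra_def openin_open by blast
  have "0 \<in> quasi_invertibles (closure D)"
    using D(1) closure_subset[of D] by (auto simp: quasi_invertibles_def)
  then have "0 \<in> U" using U by blast
  obtain F e where F: "finite F" "F \<subseteq> S" "0 < e" "{y. \<forall>s\<in>F. p s y < e} \<subseteq> U"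
    using bspec[OF iffD1[OF open_iff_seminorms U(1)] \<open>0 \<in> U\<close>] by auto
  have "cmod (f y) < 1"
    if f: "f \<in> mult_functionals smul D" and y: "y \<in> D" "\<forall>s\<in>F. p s y < e" for f y
  proof (rule ccontr)
    assume ge: "\<not> cmod (f y) < 1"
    then have "f y \<noteq> 0" by auto
    \<comment> \<open>The scalar forces \<open>f v = -1\<close>; its modulus is at most 1, so
      \<open>v\<close> stays in the ball.\<close>
    define v where "v = smul (- inverse (f y)) y"
    have v: "v \<in> D" unfolding v_def using y(1) by (rule D(4))
    have "f v = -1"
      using f y \<open>f y \<noteq> 0\<close> by (simp add: v_def mult_functionals_def del: scale_minus_left)
    have "p s v < e" if "s \<in> F" for s
    proof -
      have sn: "seminorm smul (p s)" using F that seminorms by blast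
      then have "p s v = inverse (cmod (f y)) * p s y"
        by (simp add: v_def seminorm_scale norm_inverse del: scale_minus_left)
      also have "\<dots> \<le> 1 * p s y"
        using ge sn by (intro mult_right_mono) (auto simp: seminorm_def inverse_le_1_iff)
      finally show ?thesis using y(2) that by force
    qed
    then have "v \<in> quasi_invertibles (closure D)"
      using F(4) U v closure_subset[of D] by auto
    moreover have "f \<in> cont_mult_functionals smul D"
      using f assms(1) by (simp add: functionally_continuous_def)
    ultimately show False
      using quasi_invertible_functional_neq v D \<open>f v = -1\<close> by blast
  qed
  with F that show ?thesis by blast
qed

theorem theorem3p3:
  fixes scaleA :: "complex \<Rightarrow> 'a::{ring, topological_ab_group_add, t2_space} \<Rightarrow> 'a"
    and p :: "'s \<Rightarrow> 'a \<Rightarrow> real" and S :: "'s set"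
    and scaleB :: "complex \<Rightarrow> 'b::{ring, topological_ab_group_add, t2_space} \<Rightarrow> 'b"
    and q :: "'t \<Rightarrow> 'b \<Rightarrow> real" and T :: "'t set"
    and \<phi> :: "'a \<Rightarrow> 'b"
  assumes "locally_convex_algebra scaleA p S"
    and "property_P scaleA p S"
    and "locally_convex_algebra scaleB q T"
    and "algebra_hom scaleA scaleB \<phi>"
    and "inj \<phi>"
    and "functionally_continuous scaleB (range \<phi>)"
    and "continuous_product (range \<phi>)"
    and "Q_algebra (closure (range \<phi>))"
  shows "continuous_on (range \<phi>) (inv \<phi>)"
proof -
  interpret A: locally_convex_algebra scaleA p S by fact
  interpret B: locally_convex_algebra scaleB q T by fact
  interpret lin: Vector_Spaces.linear scaleA scaleB \<phi>
    using assms(4) by (simp add: algebra_hom_def)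
  have mult: "\<phi> (a * b) = \<phi> a * \<phi> b" for a b
    using assms(4) by (simp add: algebra_hom_def)
  obtain F e where F: "finite F" "F \<subseteq> T" "0 < e"
    and bound: "\<And>f y. f \<in> mult_functionals scaleB (range \<phi>) \<Longrightarrow> y \<in> range \<phi> \<Longrightarrow>
      \<forall>t\<in>F. q t y < e \<Longrightarrow> cmod (f y) < 1"
  proof (rule B.functionals_bounded_near_0[OF assms(6,8)])
    show "0 \<in> range \<phi>"
      by (metis lin.zero rangeI)
  qed (auto simp flip: lin.add lin.scale mult)
  \<comment> \<open>The same \<open>F\<close> and \<open>e\<close> work for every
    \<open>s\<close>.\<close>
  have small: "p s a < 1" if s: "s \<in> S" and a: "\<forall>t\<in>F. q t (\<phi> a) < e" for s a
  proof (rule ccontr)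
    assume ge: "\<not> p s a < 1"
    \<comment> \<open>Normalised for property (P); as \<open>p s a \<ge> 1\<close>, the scaling only
      shrinks, so \<open>\<phi> b\<close> remains in the ball.\<close>
    define b where "b = scaleA (of_real (inverse (p s a))) a"
    have "p s b = 1"
      using ge s A.seminorms by (simp add: b_def seminorm_scale norm_inverse)
    then obtain f where f: "f \<in> mult_functionals scaleA UNIV" "1 \<le> cmod (f b)"
      using assms(2) s unfolding property_P_def by blast
    have "q t (\<phi> b) < e" if "t \<in> F" for t
    proof -
      have sn: "seminorm scaleB (q t)" using F that B.seminorms by blast
      then have "q t (\<phi> b) = inverse (p s a) * q t (\<phi> a)"
        using ge by (simp add: b_def lin.scale seminorm_scale norm_inverse)
      also have "\<dots> \<le> 1 * q t (\<phi> a)"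
        using ge sn by (intro mult_right_mono) (auto simp: seminorm_def inverse_le_1_iff)
      finally show ?thesis using a that by force
    qed
    then have "cmod (restrict (f \<circ> inv \<phi>) (range \<phi>) (\<phi> b)) < 1"
      by (intro bound mult_functionals_range[OF assms(4,5) f(1)]) auto
    with f(2) show False
      using assms(5) by simp
  qed
  show ?thesis
    unfolding continuous_on_topological
  proof (intro ballI allI impI)
    fix x O' assume "x \<in> range \<phi>" and O': "open O'" "inv \<phi> x \<in> O'"
    then obtain a where x: "x = \<phi> a" by blast
    then have "a \<in> O'" using O' assms(5) by simp
    then obtain G d where G: "G \<subseteq> S" "0 < d" "{y. \<forall>s\<in>G. p s (y - a) < d} \<subseteq> O'"
      using O'(1) unfolding A.open_iff_seminorms by blast
    \<comment> \<open>Division by \<open>d\<close> turns the radius \<open>e * d\<close> into the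
      \<open>e\<close> required by \<open>small\<close>, and the resulting bound 1 becomes
      \<open>d\<close> after scaling back.\<close>
    define V where "V = (\<lambda>y. y - x) -` {y. \<forall>t\<in>F. q t y < e * d}"
    have "open V"
      unfolding V_def by (intro open_vimage B.open_seminorm_ball F continuous_intros)
    moreover have "x \<in> V"
    proof -
      \<comment> \<open>Homogeneity with the scalar 0.\<close>
      have "q t 0 = 0" if "t \<in> F" for t
        using seminorm_scale[of scaleB "q t" 0 0] F that B.seminorms by auto
      then show ?thesis using F G by (simp add: V_def)
    qed
    moreover have "inv \<phi> y \<in> O'" if y: "y \<in> range \<phi>" "y \<in> V" for y
    proof -
      obtain b where b: "y = \<phi> b" using y by blast
      define c where "c = scaleA (of_real (inverse d)) (b - a)"
      have "q t (\<phi> c) < e" if "t \<in> F" for t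
      proof -
        have "seminorm scaleB (q t)" using F that B.seminorms by blast
        then have "q t (\<phi> c) = inverse d * q t (y - x)"
          using G by (simp add: c_def b x lin.scale lin.diff seminorm_scale norm_inverse)
        also have "\<dots> < e"
          using y(2) that G by (simp add: V_def field_simps)
        finally show ?thesis .
      qed
      then have "p s c < 1" if "s \<in> G" for s
        using small that G by blast
      moreover have "p s c = inverse d * p s (b - a)" if "s \<in> G" for s
        unfolding c_def using that G A.seminorms
        by (subst seminorm_scale[of scaleA]) (auto simp: norm_inverse)
      ultimately have "p s (b - a) < d" if "s \<in> G" for s
        using that G by (simp add: field_simps)
      then show ?thesis
        using G(3) b assms(5) by auto
    qed
    ultimately show "\<exists>V. open V \<and> x \<in> V \<and> (\<forall>y\<in>range \<phi>. y \<in> V \<longrightarrow> inv \<phi> y \<in> O')"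
      by blast
  qed
qed

end
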